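(* Fix $d\ge 3$, $c>0$ and $\delta<\frac{d-1}{d+1}$, let $p=(c+o_n(1))n^{-d+1+\delta}$, and let $\mathcal{H}$ be the random $d$-uniform hypergraph on $[n]$ with each $d$-subset a hyperedge independently with probability $p$. Then almost exact recovery is possible, i.e. the partial recovery loss is $o_n(1)$.
   Context: $\mathrm{Proj}(H)$ is the graph on $[n]$ with $\{i,j\}$ an edge iff some hyperedge of $H$ contains $\{i,j\}$. The partial recovery loss is $\min_{\mathcal{B}}\mathbb{E}[|\mathcal{B}(\mathrm{Proj}(\mathcal{H}))\Delta E(\mathcal{H})|]/(p\binom{n}{d})$, the minimum over all functions $\mathcal{B}$ mapping projected graphs to sets of $d$-subsets of $[n]$. *)

theory Defs
  imports
    "HOL-Probability.Probability"
    "HOL-Library.Ramsey"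
    "HOL-Library.Landau_Symbols"
begin

text \<open>
  Graphs and \<open>d\<close>-uniform hypergraphs on the fixed vertex set \<open>{1..n}\<close> are represented by
  their edge sets: a graph is a subset of \<open>nsets {1..n} 2\<close>, a \<open>d\<close>-uniform hypergraph a subset
  of \<open>nsets {1..n} d\<close>.
\<close>

definition Proj :: "nat \<Rightarrow> nat set set \<Rightarrow> nat set set" where
  "Proj n H = {e \<in> nsets {1..n} 2. \<exists>h\<in>H. e \<subseteq> h}"

text \<open>
  The parameter of \<^const>\<open>bernoulli_pmf\<close> is clamped to \<open>[0, 1]\<close>, so this is the intended
  law exactly when \<open>p\<close> lies in that interval.
\<close>

definition random_hypergraph :: "nat \<Rightarrow> nat \<Rightarrow> real \<Rightarrow> nat set set pmf" where
  "random_hypergraph n d p =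
     map_pmf (\<lambda>f. {h \<in> nsets {1..n} d. f h})
       (Pi_pmf (nsets {1..n} d) False (\<lambda>_. bernoulli_pmf p))"

definition projected_graphs :: "nat \<Rightarrow> nat \<Rightarrow> nat set set set" where
  "projected_graphs n d = Proj n ` Pow (nsets {1..n} d)"

text \<open>
  The extensional function space makes the set of recovery functions finite and nonempty, so that
  \<^const>\<open>Min\<close> is a genuine minimum.
\<close>

definition recovery_functions :: "nat \<Rightarrow> nat \<Rightarrow> (nat set set \<Rightarrow> nat set set) set" where
  "recovery_functions n d = projected_graphs n d \<rightarrow>\<^sub>E Pow (nsets {1..n} d)"

definition partial_recovery_loss :: "nat \<Rightarrow> nat \<Rightarrow> real \<Rightarrow> real" where
  "partial_recovery_loss n d p =
     Min ((\<lambda>B. measure_pmf.expectation (random_hypergraph n d p)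
                  (\<lambda>H. real (card (sym_diff (B (Proj n H)) H))))
          ` recovery_functions n d)
     / (p * real (n choose d))"

definition almost_exact_recovery :: "nat \<Rightarrow> (nat \<Rightarrow> real) \<Rightarrow> bool" where
  "almost_exact_recovery d p \<longleftrightarrow>
     (\<lambda>n. partial_recovery_loss n d (p n)) \<in> o(\<lambda>_. 1)"

end

theory Submission
  imports Defs
begin

text \<open>
  The recovery function returns every \<open>d\<close>-clique of the projected graph, so its only errors are
  \<open>d\<close>-sets \<open>h\<close> outside the hypergraph all of whose pairs are covered by other hyperedges. Such a
  cover is recorded by the traces \<open>S = g \<inter> h\<close>, and a trace of size \<open>s\<close> appears with probability
  at most \<open>n\<^sup>d\<^sup>-\<^sup>s p\<close>, of order \<open>n\<close> to the power \<open>1 + \<delta> - s\<close>. At the threshold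
  \<open>\<delta>\<^sub>0 = (d - 1) / (d + 1)\<close> the cost \<open>s - 1 - \<delta>\<^sub>0\<close> is at least \<open>2 / (d + 1)\<close> per covered pair,
  because the difference is concave in \<open>s\<close> and vanishes at \<open>s = 2\<close> and \<open>s = d\<close>. Hence every cover
  costs at least \<open>d - 1 - \<delta>\<^sub>0\<close>, and as it has two or more traces, lowering \<open>\<delta>\<close> below \<open>\<delta>\<^sub>0\<close> makes
  it rarer than a hyperedge by a polynomial factor.
\<close>

section \<open>Independent Bernoulli families: probabilities of joint occurrence\<close>

lemma prob_Pi_pmf_bernoulli_all_le:
  assumes "finite A" "X \<subseteq> A" "p \<ge> 0"
  shows "measure_pmf.prob (Pi_pmf A False (\<lambda>_. bernoulli_pmf p)) {f. \<forall>x\<in>X. f x} \<le> p ^ card X"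
proof -
  \<comment> \<open>\<open>bernoulli_pmf\<close> clamps its parameter, so for p > 1 the probability
    of \<open>True\<close> is no longer p; the bound survives because p then exceeds every
    probability.\<close>
  have b: "measure_pmf.prob (bernoulli_pmf p) {True} \<le> p"
  proof (cases "p \<le> 1")
    case True
    then show ?thesis using assms by (simp add: measure_pmf_single)
  next
    case False
    then show ?thesis using measure_pmf.prob_le_1[of "bernoulli_pmf p" "{True}"] by linarith
  qed
  have "{f. \<forall>x\<in>X. f x} = Pi A (\<lambda>x. if x \<in> X then {True} else UNIV)"
    using assms(2) by (auto simp: Pi_def)
  then have "measure_pmf.prob (Pi_pmf A False (\<lambda>_. bernoulli_pmf p)) {f. \<forall>x\<in>X. f x}
      = (\<Prod>x\<in>A. measure_pmf.prob (bernoulli_pmf p) (if x \<in> X then {True} else UNIV))"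
    by (simp only: measure_Pi_pmf_Pi[OF assms(1)])
  also have "\<dots> = (\<Prod>x\<in>A. if x \<in> X then measure_pmf.prob (bernoulli_pmf p) {True} else 1)"
    by (intro prod.cong) auto
  also have "\<dots> = (\<Prod>x\<in>X. measure_pmf.prob (bernoulli_pmf p) {True})"
    using assms by (subst prod.If_cases) (auto simp: Int_absorb1)
  also have "\<dots> \<le> p ^ card X"
    using b by (simp add: power_mono)
  finally show ?thesis .
qed

text \<open>Union bound over the choice functions that pick one successful element from each class.
  Disjointness makes every choice injective, so it names \<open>card I\<close> distinct independent
  trials and costs a full \<open>p ^ card I\<close>.\<close>

lemma prob_Pi_pmf_bernoulli_hits_le:
  assumes "finite A" "finite I" "\<And>i. i \<in> I \<Longrightarrow> C i \<subseteq> A" "disjoint_family_on C I" "p \<ge> 0"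
  shows "measure_pmf.prob (Pi_pmf A False (\<lambda>_. bernoulli_pmf p)) {f. \<forall>i\<in>I. \<exists>x\<in>C i. f x}
    \<le> (\<Prod>i\<in>I. real (card (C i)) * p)" (is "measure_pmf.prob ?M _ \<le> _")
proof -
  have finC: "finite (C i)" if "i \<in> I" for i
    using assms(1,3) that finite_subset by blast
  have finP: "finite (PiE I C)"
    using assms(2) finC by (intro finite_PiE) auto
  have "{f. \<forall>i\<in>I. \<exists>x\<in>C i. f x} \<subseteq> (\<Union>g\<in>PiE I C. {f. \<forall>x\<in>g ` I. f x})"
  proof
    fix f assume "f \<in> {f. \<forall>i\<in>I. \<exists>x\<in>C i. f x}"
    then obtain g where g: "\<And>i. i \<in> I \<Longrightarrow> g i \<in> C i \<and> f (g i)"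
      by simp metis
    then have "restrict g I \<in> PiE I C" "\<forall>x\<in>restrict g I ` I. f x"
      by auto
    then show "f \<in> (\<Union>g\<in>PiE I C. {f. \<forall>x\<in>g ` I. f x})"
      by blast
  qed
  then have "measure_pmf.prob ?M {f. \<forall>i\<in>I. \<exists>x\<in>C i. f x}
      \<le> measure_pmf.prob ?M (\<Union>g\<in>PiE I C. {f. \<forall>x\<in>g ` I. f x})"
    by (intro measure_pmf.finite_measure_mono) auto
  also have "\<dots> \<le> (\<Sum>g\<in>PiE I C. measure_pmf.prob ?M {f. \<forall>x\<in>g ` I. f x})"
    by (intro measure_pmf.finite_measure_subadditive_finite finP) auto
  also have "\<dots> \<le> (\<Sum>g\<in>PiE I C. p ^ card I)"
  proof (intro sum_mono)
    fix g assume g: "g \<in> PiE I C"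
    have "inj_on g I"
    proof (rule inj_onI)
      fix i j assume ij: "i \<in> I" "j \<in> I" "g i = g j"
      then have "g i \<in> C i" "g i \<in> C j"
        using g by (metis PiE_mem)+
      then show "i = j"
        using assms(4) ij(1,2) unfolding disjoint_family_on_def by blast
    qed
    then have "card (g ` I) = card I"
      by (rule card_image)
    moreover have "g ` I \<subseteq> A"
      using assms(3) g by (auto dest: PiE_mem)
    ultimately show "measure_pmf.prob ?M {f. \<forall>x\<in>g ` I. f x} \<le> p ^ card I"
      using prob_Pi_pmf_bernoulli_all_le[OF assms(1) _ assms(5), of "g ` I"] by simp
  qed
  also have "\<dots> = (\<Prod>i\<in>I. real (card (C i)) * p)"
    using assms(2) by (simp add: card_PiE prod.distrib)
  finally show ?thesis .
qed

section \<open>Covers of the pairs of a vertex set, and their cost\<close>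

text \<open>The members stand for traces on \<open>h\<close> of hyperedges other than
  \<open>h\<close>: equal uniformity makes such traces proper, and those with fewer than two
  vertices cover no pair.\<close>

definition clique_covers :: "'a set \<Rightarrow> 'a set set set" where
  "clique_covers h = {F. F \<subseteq> {S. S \<subset> h \<and> 2 \<le> card S} \<and> nsets h 2 \<subseteq> (\<Union>S\<in>F. nsets S 2)}"

text \<open>A member is a proper subset, so it misses some vertex x; the pair of x with a vertex of
  that member needs another member.\<close>

lemma card_clique_cover_ge_2:
  assumes "finite h" "card h \<ge> 2" "F \<in> clique_covers h"
  shows "card F \<ge> 2"
proof -
  have F: "F \<subseteq> {S. S \<subset> h \<and> 2 \<le> card S}" "nsets h 2 \<subseteq> (\<Union>S\<in>F. nsets S 2)"
    using assms(3) by (auto simp: clique_covers_def)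
  have pair: "\<exists>S\<in>F. x \<in> S \<and> y \<in> S" if "x \<in> h" "y \<in> h" "x \<noteq> y" for x y
  proof -
    have "{x, y} \<in> nsets h 2"
      using that by (auto simp: nsets_def)
    then have "{x, y} \<in> (\<Union>S\<in>F. nsets S 2)"
      using F(2) by blast
    then show ?thesis
      by (auto simp: nsets_def)
  qed
  have "finite F"
    using F(1) assms(1) by (intro finite_subset[of F "Pow h"]) auto
  obtain a b where "a \<in> h" "b \<in> h" "a \<noteq> b"
    using assms(1,2) by (metis card_le_Suc0_iff_eq not_less_eq_eq numeral_2_eq_2)
  then obtain S where S: "S \<in> F" "a \<in> S"
    using pair by blast
  then obtain x where x: "x \<in> h" "x \<notin> S"
    using F(1) by blast
  then obtain T where "T \<in> F" "x \<in> T"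
    using pair[of x a] \<open>a \<in> h\<close> S(2) by blast
  then have "{S, T} \<subseteq> F" "S \<noteq> T"
    using S x by auto
  then show ?thesis
    using card_mono[OF \<open>finite F\<close> \<open>{S, T} \<subseteq> F\<close>] by simp
qed

lemma pair_cost_ge:
  fixes s d :: real
  assumes "2 \<le> s" "s \<le> d"
  shows "2 / (d + 1) * (s * (s - 1) / 2) \<le> s - 1 - (d - 1) / (d + 1)"
proof -
  have "d + 1 \<noteq> 0"
    using assms by simp
  have "s - 1 - (d - 1) / (d + 1) = (s * (d + 1) - 2 * d) / (d + 1)"
    using assms by (simp add: field_simps)
  \<comment> \<open>After multiplication by d + 1, the right side of the claim minus the left is
    exactly this product.\<close>
  moreover have "0 \<le> (s - 2) * (d - s)"
    using assms by simp
  then have "s * (s - 1) / (d + 1) \<le> (s * (d + 1) - 2 * d) / (d + 1)"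
    using assms by (intro divide_right_mono) (auto simp: algebra_simps)
  moreover have "2 / (d + 1) * (s * (s - 1) / 2) = s * (s - 1) / (d + 1)"
    using \<open>d + 1 \<noteq> 0\<close> by (simp add: divide_simps)
  ultimately show ?thesis
    by presburger
qed

lemma real_choose_two: "real (m choose 2) = real m * (real m - 1) / 2"
proof (induction m)
  case (Suc m)
  have "Suc m choose 2 = m + (m choose 2)"
    by (simp add: numeral_2_eq_2)
  then show ?case
    using Suc by (simp add: field_simps)
qed simp

text \<open>With p of order n to the power -(d - 1 - \<delta>), the left side is the cost of one
  hyperedge plus the gap to the threshold; this surplus is the polynomial gain of the whole
  argument.\<close>

lemma clique_cover_cost_ge:
  assumes h: "finite h" "card h = d" "d \<ge> 3" and F: "F \<in> clique_covers h"
    and \<delta>: "\<delta> \<le> (real d - 1) / (real d + 1)"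
  shows "real d - 1 - \<delta> + ((real d - 1) / (real d + 1) - \<delta>) \<le> (\<Sum>S\<in>F. real (card S) - 1 - \<delta>)"
proof -
  define \<delta>\<^sub>0 where "\<delta>\<^sub>0 = (real d - 1) / (real d + 1)"
  have FS: "S \<subset> h" "finite S" "2 \<le> card S" "card S \<le> d" if "S \<in> F" for S
    using F that h by (auto simp: clique_covers_def intro: finite_subset card_mono)
  have cov: "nsets h 2 \<subseteq> (\<Union>S\<in>F. nsets S 2)"
    using F by (auto simp: clique_covers_def)
  have "finite F"
    using FS(1) h(1) by (intro finite_subset[of F "Pow h"]) auto
  have "d choose 2 = card (nsets h 2)"
    using h by (simp add: card_nsets)
  also have "\<dots> \<le> card (\<Union>S\<in>F. nsets S 2)"
    using cov \<open>finite F\<close> FS by (intro card_mono finite_UN_I finite_imp_finite_nsets) auto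
  also have "\<dots> \<le> (\<Sum>S\<in>F. card (nsets S 2))"
    using \<open>finite F\<close> by (rule card_UN_le)
  also have "\<dots> = (\<Sum>S\<in>F. card S choose 2)"
    by (simp add: card_nsets)
  finally have "real (d choose 2) \<le> (\<Sum>S\<in>F. real (card S choose 2))"
    unfolding of_nat_sum[symmetric] of_nat_le_iff .
  then have pairs: "real d * (real d - 1) / 2 \<le> (\<Sum>S\<in>F. real (card S) * (real (card S) - 1) / 2)"
    by (simp only: real_choose_two)
  \<comment> \<open>The equality case s = d of \<open>pair_cost_ge\<close>: a hyperedge pays exactly
    the minimal price for each of its pairs.\<close>
  have "real d - 1 - \<delta>\<^sub>0 = 2 / (real d + 1) * (real d * (real d - 1) / 2)"
    by (simp add: \<delta>\<^sub>0_def field_simps)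
  also have "\<dots> \<le> 2 / (real d + 1) * (\<Sum>S\<in>F. real (card S) * (real (card S) - 1) / 2)"
    using pairs by (intro mult_left_mono) auto
  also have "\<dots> \<le> (\<Sum>S\<in>F. real (card S) - 1 - \<delta>\<^sub>0)"
    unfolding sum_distrib_left \<delta>\<^sub>0_def using FS by (intro sum_mono pair_cost_ge) auto
  finally have base: "real d - 1 - \<delta>\<^sub>0 \<le> (\<Sum>S\<in>F. real (card S) - 1 - \<delta>\<^sub>0)" .
  \<comment> \<open>Passing from \<open>\<delta>\<^sub>0\<close> to \<delta> adds one gap per
    member. Of the at least two gaps, one raises the hyperedge cost to d - 1 - \<delta> and the
    other is the surplus.\<close>
  have "2 * (\<delta>\<^sub>0 - \<delta>) \<le> real (card F) * (\<delta>\<^sub>0 - \<delta>)"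
    using card_clique_cover_ge_2[OF h(1) _ F] h \<delta> by (intro mult_right_mono) (auto simp: \<delta>\<^sub>0_def)
  then have "real d - 1 - \<delta> + (\<delta>\<^sub>0 - \<delta>)
      \<le> (\<Sum>S\<in>F. real (card S) - 1 - \<delta>\<^sub>0) + real (card F) * (\<delta>\<^sub>0 - \<delta>)"
    using base by argo
  also have "\<dots> = (\<Sum>S\<in>F. real (card S) - 1 - \<delta>)"
    by (simp add: sum_subtractf algebra_simps)
  finally show ?thesis
    by (simp only: \<delta>\<^sub>0_def)
qed

text \<open>A crude bound suffices: it depends on \<open>card h\<close> alone, so a union bound over
  covers costs a factor constant in n.\<close>

lemma card_clique_covers_le:
  assumes "finite h"
  shows "finite (clique_covers h)" "card (clique_covers h) \<le> 2 ^ (2 ^ card h)"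
proof -
  have sub: "clique_covers h \<subseteq> Pow (Pow h)"
    by (auto simp: clique_covers_def)
  then show "finite (clique_covers h)"
    using assms by (meson finite_Pow_iff finite_subset)
  show "card (clique_covers h) \<le> 2 ^ (2 ^ card h)"
  proof -
    have "card (clique_covers h) \<le> card (Pow (Pow h))"
      using sub assms by (intro card_mono) auto
    also have "\<dots> = 2 ^ (2 ^ card h)"
      using assms by (simp only: card_Pow finite_Pow_iff)
    finally show ?thesis .
  qed
qed

section \<open>Traces of hyperedges and the probability of a false clique\<close>

text \<open>Once its trace S is fixed, g is determined by the remaining \<open>d - card S\<close>
  vertices.\<close>

lemma card_trace_class_le:
  assumes "finite V" "S \<subseteq> h" "card S \<le> d"
  shows "card {g \<in> nsets V d. g \<inter> h = S} \<le> card V ^ (d - card S)"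
proof (cases "d - card S \<le> card V")
  case True
  have "card {g \<in> nsets V d. g \<inter> h = S} \<le> card (nsets V (d - card S))"
  proof (rule card_inj_on_le)
    show "inj_on (\<lambda>g. g - S) {g \<in> nsets V d. g \<inter> h = S}"
      by (rule inj_onI) blast
    show "(\<lambda>g. g - S) ` {g \<in> nsets V d. g \<inter> h = S} \<subseteq> nsets V (d - card S)"
    proof clarify
      fix g assume g: "g \<in> nsets V d" "S = g \<inter> h"
      then show "g - g \<inter> h \<in> nsets V (d - card (g \<inter> h))"
        by (auto simp: nsets_def card_Diff_subset)
    qed
    show "finite (nsets V (d - card S))"
      using assms(1) by (rule finite_imp_finite_nsets)
  qed
  also have "\<dots> \<le> card V ^ (d - card S)"
    using True by (simp add: card_nsets binomial_le_pow)
  finally show ?thesis .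
next
  \<comment> \<open>Here V has fewer than d vertices, so the class is empty.\<close>
  case False
  have "g \<notin> nsets V d" for g
  proof
    assume "g \<in> nsets V d"
    then have "d \<le> card V"
      using assms(1) by (auto simp: nsets_def card_mono)
    then show False
      using False by linarith
  qed
  then show ?thesis by auto
qed

text \<open>The cover consists of all traces of size at least 2. Recording traces rather than
  hyperedges merges hyperedges with the same trace, so distinct members are witnessed by disjoint
  classes of hyperedges.\<close>

lemma false_clique_imp_traces:
  assumes h: "h \<in> nsets {1..n} d" "h \<notin> H" and H: "H \<subseteq> nsets {1..n} d"
    and clique: "nsets h 2 \<subseteq> Proj n H"
  shows "\<exists>F\<in>clique_covers h. \<forall>S\<in>F. \<exists>g\<in>H. g \<inter> h = S"
proof -
  define F where "F = {S \<in> (\<lambda>g. g \<inter> h) ` H. 2 \<le> card S}"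
  have fin: "finite h" "card h = d" "\<And>g. g \<in> H \<Longrightarrow> finite g \<and> card g = d"
    using h H by (auto simp: nsets_def)
  have proper: "g \<inter> h \<subset> h" if "g \<in> H" for g
  proof -
    have "g \<inter> h \<noteq> h"
    proof
      assume "g \<inter> h = h"
      then have "h \<subseteq> g" by blast
      then have "h = g"
        using fin that by (intro card_subset_eq) auto
      then show False using h that by simp
    qed
    then show ?thesis by blast
  qed
  have "e \<in> (\<Union>S\<in>F. nsets S 2)" if e: "e \<in> nsets h 2" for e
  proof -
    obtain g where g: "g \<in> H" "e \<subseteq> g"
      using clique e by (auto simp: Proj_def)
    have e': "e \<subseteq> h" "finite e" "card e = 2"
      using e by (auto simp: nsets_def)
    have "card e \<le> card (g \<inter> h)"
      using g e' fin by (intro card_mono) auto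
    then have "g \<inter> h \<in> F"
      using g e' by (auto simp: F_def)
    moreover have "e \<in> nsets (g \<inter> h) 2"
      using g e' by (auto simp: nsets_def)
    ultimately show ?thesis by blast
  qed
  then have "F \<in> clique_covers h"
    using proper by (auto simp: clique_covers_def F_def)
  moreover have "\<forall>S\<in>F. \<exists>g\<in>H. g \<inter> h = S"
    unfolding F_def by blast
  ultimately show ?thesis
    by blast
qed

text \<open>A union bound over covers: each trace contributes the size of its class times p, and
  \<open>clique_cover_cost_ge\<close> bounds the total exponent. The resulting exponent is that of p
  lowered by the gap.\<close>

lemma prob_false_clique_le:
  assumes h: "h \<in> nsets {1..n} d" and d: "d \<ge> 3" and n: "n \<ge> 1" and p: "0 \<le> p"
    and pK: "p \<le> K * real n powr (- real d + 1 + \<delta>)" and K: "K \<ge> 1"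
    and \<delta>: "\<delta> \<le> (real d - 1) / (real d + 1)"
  shows "measure_pmf.prob (random_hypergraph n d p) {H. h \<notin> H \<and> nsets h 2 \<subseteq> Proj n H}
    \<le> 2 ^ 2 ^ d * K ^ 2 ^ d * real n powr (- real d + 1 + \<delta> - ((real d - 1) / (real d + 1) - \<delta>))"
    (is "_ \<le> _ * _ * real n powr ?e")
proof -
  define A where "A = nsets {1..n} d"
  define C where "C S = {g \<in> A. g \<inter> h = S}" for S
  define M where "M = Pi_pmf A False (\<lambda>_. bernoulli_pmf p)"
  have finA: "finite A"
    by (simp add: A_def finite_imp_finite_nsets)
  have hd: "finite h" "card h = d"
    using h by (auto simp: nsets_def)
  have "measure_pmf.prob (random_hypergraph n d p) {H. h \<notin> H \<and> nsets h 2 \<subseteq> Proj n H}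
      = measure_pmf.prob M {f. h \<notin> {g \<in> A. f g} \<and> nsets h 2 \<subseteq> Proj n {g \<in> A. f g}}"
    by (simp add: random_hypergraph_def A_def M_def vimage_def)
  also have "\<dots> \<le> measure_pmf.prob M (\<Union>F\<in>clique_covers h. {f. \<forall>S\<in>F. \<exists>g\<in>C S. f g})"
  proof (intro measure_pmf.finite_measure_mono subsetI)
    fix f assume "f \<in> {f. h \<notin> {g \<in> A. f g} \<and> nsets h 2 \<subseteq> Proj n {g \<in> A. f g}}"
    then have "\<exists>F\<in>clique_covers h. \<forall>S\<in>F. \<exists>g\<in>{g \<in> A. f g}. g \<inter> h = S"
      using h by (intro false_clique_imp_traces[where d = d]) (auto simp: A_def)
    then show "f \<in> (\<Union>F\<in>clique_covers h. {f. \<forall>S\<in>F. \<exists>g\<in>C S. f g})"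
      by (fastforce simp: C_def)
  qed auto
  also have "\<dots> \<le> (\<Sum>F\<in>clique_covers h. measure_pmf.prob M {f. \<forall>S\<in>F. \<exists>g\<in>C S. f g})"
    using card_clique_covers_le hd(1)
    by (intro measure_pmf.finite_measure_subadditive_finite) auto
  also have "\<dots> \<le> (\<Sum>F\<in>clique_covers h. K ^ 2 ^ d * real n powr ?e)"
  proof (rule sum_mono)
    fix F assume F: "F \<in> clique_covers h"
    then have FS: "S \<subset> h" "2 \<le> card S" if "S \<in> F" for S
      using that by (auto simp: clique_covers_def)
    have FPow: "F \<subseteq> Pow h"
      using FS by auto
    then have finF: "finite F"
      using hd(1) by (meson finite_Pow_iff finite_subset)
    have cardF: "card F \<le> 2 ^ d"
      using card_mono[OF _ FPow] hd by (simp only: card_Pow finite_Pow_iff)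
    have "measure_pmf.prob M {f. \<forall>S\<in>F. \<exists>g\<in>C S. f g} \<le> (\<Prod>S\<in>F. real (card (C S)) * p)"
      unfolding M_def using finA finF p
      by (intro prob_Pi_pmf_bernoulli_hits_le) (auto simp: C_def disjoint_family_on_def)
    also have "\<dots> \<le> (\<Prod>S\<in>F. K * real n powr - (real (card S) - 1 - \<delta>))"
    proof (rule prod_mono, intro conjI)
      fix S assume S: "S \<in> F"
      show "0 \<le> real (card (C S)) * p"
        using p by simp
      have Sd: "card S \<le> d"
        using FS[OF S] hd by (metis card_mono psubset_imp_subset)
      have "card (C S) \<le> n ^ (d - card S)"
        using card_trace_class_le[of "{1..n}" S h d] FS[OF S] Sd by (auto simp: C_def A_def)
      moreover have "real (n ^ (d - card S)) = real n powr (real d - real (card S))"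
        using n Sd by (simp add: powr_realpow flip: of_nat_diff)
      ultimately have "real (card (C S)) \<le> real n powr (real d - real (card S))"
        by (metis of_nat_le_iff)
      then have "real (card (C S)) * p
          \<le> real n powr (real d - real (card S)) * (K * real n powr (- real d + 1 + \<delta>))"
        using p pK by (intro mult_mono) auto
      also have "\<dots> = K * real n powr - (real (card S) - 1 - \<delta>)"
        by (simp add: powr_add[symmetric] mult.left_commute algebra_simps)
      finally show "real (card (C S)) * p \<le> K * real n powr - (real (card S) - 1 - \<delta>)" .
    qed
    also have "\<dots> = K ^ card F * real n powr (\<Sum>S\<in>F. - (real (card S) - 1 - \<delta>))"
      using n finF by (simp add: prod.distrib powr_sum)
    also have "\<dots> \<le> K ^ 2 ^ d * real n powr ?e"
    proof (intro mult_mono)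
      \<comment> \<open>\<open>K \<ge> 1\<close> allows the exponent to be replaced by one
        independent of the cover.\<close>
      show "K ^ card F \<le> K ^ 2 ^ d"
        using K cardF by (intro power_increasing)
      have "(\<Sum>S\<in>F. - (real (card S) - 1 - \<delta>)) \<le> ?e"
        using clique_cover_cost_ge[OF hd d F \<delta>] unfolding sum_negf by linarith
      then show "real n powr (\<Sum>S\<in>F. - (real (card S) - 1 - \<delta>)) \<le> real n powr ?e"
        using n by (intro powr_mono) auto
    qed (use K in auto)
    finally show "measure_pmf.prob M {f. \<forall>S\<in>F. \<exists>g\<in>C S. f g} \<le> K ^ 2 ^ d * real n powr ?e" .
  qed
  also have "\<dots> = real (card (clique_covers h)) * (K ^ 2 ^ d * real n powr ?e)"
    by simp
  also have "\<dots> \<le> 2 ^ 2 ^ d * (K ^ 2 ^ d * real n powr ?e)"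
  proof (rule mult_right_mono)
    have "real (card (clique_covers h)) \<le> real (2 ^ 2 ^ d)"
      using card_clique_covers_le(2)[OF hd(1)] hd(2) of_nat_le_iff by blast
    then show "real (card (clique_covers h)) \<le> 2 ^ 2 ^ d"
      by simp
  qed (use K in auto)
  finally show ?thesis
    by (simp add: mult.assoc)
qed

section \<open>The loss of the rule that returns every clique\<close>

lemma finite_recovery_functions: "finite (recovery_functions n d)"
  by (auto simp: recovery_functions_def projected_graphs_def finite_imp_finite_nsets
      intro!: finite_PiE)

lemma partial_recovery_loss_nonneg:
  assumes "p \<ge> 0"
  shows "partial_recovery_loss n d p \<ge> 0"
proof -
  have "recovery_functions n d \<noteq> {}"
    by (auto simp: recovery_functions_def PiE_eq_empty_iff)
  then show ?thesis
    unfolding partial_recovery_loss_def using assms finite_recovery_functions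
    by (intro divide_nonneg_nonneg) (auto intro!: integral_nonneg_AE)
qed

text \<open>The minimum is at most the loss of the clique rule, whose expected error is a sum of
  false-clique probabilities; the normalisation cancels the number of d-sets.\<close>

lemma partial_recovery_loss_le:
  assumes p: "p > 0" and q: "q \<ge> 0"
    and bound: "\<And>h. h \<in> nsets {1..n} d \<Longrightarrow>
      measure_pmf.prob (random_hypergraph n d p) {H. h \<notin> H \<and> nsets h 2 \<subseteq> Proj n H} \<le> q"
  shows "partial_recovery_loss n d p \<le> q / p"
proof -
  define A where "A = nsets {1..n} d"
  define M where "M = random_hypergraph n d p"
  define B where "B = restrict (\<lambda>G. {h \<in> A. nsets h 2 \<subseteq> G}) (projected_graphs n d)"
  have finA: "finite A"
    by (simp add: A_def finite_imp_finite_nsets)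
  have B: "B \<in> recovery_functions n d"
    by (auto simp: B_def recovery_functions_def A_def)
  have supp: "H \<subseteq> A" if "H \<in> set_pmf M" for H
    using that by (auto simp: M_def random_hypergraph_def A_def)
  then have finM: "finite (set_pmf M)"
    using finA by (intro finite_subset[of "set_pmf M" "Pow A"]) auto
  have diff: "real (card (sym_diff (B (Proj n H)) H))
      = (\<Sum>h\<in>A. indicator {H. h \<notin> H \<and> nsets h 2 \<subseteq> Proj n H} H)" if "H \<in> set_pmf M" for H
  proof -
    have H: "H \<subseteq> A"
      using supp that by blast
    have "B (Proj n H) = {h \<in> A. nsets h 2 \<subseteq> Proj n H}"
      using H by (auto simp: B_def projected_graphs_def A_def)
    \<comment> \<open>Every hyperedge is a clique of its projection, so the rule never misses one
      and errs only by false cliques.\<close>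
    moreover have "nsets h 2 \<subseteq> Proj n H" if "h \<in> H" for h
    proof -
      have "h \<subseteq> {1..n}"
        using that H by (auto simp: A_def nsets_def)
      then show ?thesis
        using that by (auto simp: Proj_def nsets_def)
    qed
    ultimately have "sym_diff (B (Proj n H)) H = {h \<in> A. h \<notin> H \<and> nsets h 2 \<subseteq> Proj n H}"
      using H by blast
    then show ?thesis
      using finA by (simp add: indicator_def sum.If_cases Int_def)
  qed
  have "measure_pmf.expectation M (\<lambda>H. real (card (sym_diff (B (Proj n H)) H)))
      = measure_pmf.expectation M
          (\<lambda>H. \<Sum>h\<in>A. indicator {H. h \<notin> H \<and> nsets h 2 \<subseteq> Proj n H} H)"
    using diff by (intro integral_cong_AE) (auto simp: AE_measure_pmf_iff)
  also have "\<dots> = (\<Sum>h\<in>A. measure_pmf.expectation M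
      (indicator {H. h \<notin> H \<and> nsets h 2 \<subseteq> Proj n H}))"
    by (rule Bochner_Integration.integral_sum) (rule integrable_measure_pmf_finite[OF finM])
  also have "\<dots> = (\<Sum>h\<in>A. measure_pmf.prob M {H. h \<notin> H \<and> nsets h 2 \<subseteq> Proj n H})"
    by simp
  also have "\<dots> \<le> (\<Sum>h\<in>A. q)"
    using bound by (intro sum_mono) (auto simp: A_def M_def)
  also have "\<dots> = real (n choose d) * q"
    by (simp add: A_def card_nsets)
  finally have E: "measure_pmf.expectation M (\<lambda>H. real (card (sym_diff (B (Proj n H)) H)))
      \<le> real (n choose d) * q" .
  have "Min ((\<lambda>B. measure_pmf.expectation M (\<lambda>H. real (card (sym_diff (B (Proj n H)) H))))
          ` recovery_functions n d)
      \<le> measure_pmf.expectation M (\<lambda>H. real (card (sym_diff (B (Proj n H)) H)))"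
    using B finite_recovery_functions by (intro Min_le) auto
  then have "partial_recovery_loss n d p \<le> real (n choose d) * q / (p * real (n choose d))"
    unfolding partial_recovery_loss_def M_def[symmetric] using E p
    by (intro divide_right_mono) auto
  \<comment> \<open>For n < d the binomial is 0 and the quotient is 0 by the convention for division
    by zero.\<close>
  also have "\<dots> \<le> q / p"
    using p q by (cases "n choose d = 0") auto
  finally show ?thesis .
qed

section \<open>Asymptotics below the threshold\<close>

theorem theorem8:
  fixes d :: nat and c \<delta> :: real and p \<epsilon> :: "nat \<Rightarrow> real"
  assumes "d \<ge> 3"
    and "c > 0"
    and "\<delta> < (real d - 1) / (real d + 1)"
    and "\<epsilon> \<in> o(\<lambda>_. 1)"
    and "\<forall>\<^sub>F n in sequentially. p n = (c + \<epsilon> n) * real n powr (- real d + 1 + \<delta>)"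
  shows "almost_exact_recovery d p"
proof -
  define \<eta> where "\<eta> = (real d - 1) / (real d + 1) - \<delta>"
  \<comment> \<open>Eventually c + \<epsilon> lies between c/2 and 2c: K comes from the upper bound,
    raised to at least 1 as \<open>prob_false_clique_le\<close> requires, and the divisor c/2 in W
    from the lower one.\<close>
  define K where "K = max 1 (2 * c)"
  define W where "W = 2 ^ 2 ^ d * K ^ 2 ^ d / (c / 2)"
  have \<eta>: "\<eta> > 0"
    using assms(3) by (simp add: \<eta>_def)
  have "\<epsilon> \<longlonglongrightarrow> 0"
    using smalloD_tendsto[OF assms(4)] by simp
  then have ev: "\<forall>\<^sub>F n in sequentially. - (c / 2) < \<epsilon> n" "\<forall>\<^sub>F n in sequentially. \<epsilon> n < c"
    using assms(2) by (auto intro: order_tendstoD)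
  have bounds: "\<forall>\<^sub>F n in sequentially. 0 \<le> partial_recovery_loss n d (p n)
      \<and> partial_recovery_loss n d (p n) \<le> W * real n powr (- \<eta>)"
    using assms(5) ev eventually_ge_at_top[of 1]
  proof eventually_elim
    case (elim n)
    define x where "x = real n powr (- real d + 1 + \<delta>)"
    \<comment> \<open>Positivity rests on n \<ge> 1, since \<open>0 powr a = 0\<close>.\<close>
    have x: "x > 0"
      using elim by (simp add: x_def)
    have pn: "p n = (c + \<epsilon> n) * x"
      using elim by (simp add: x_def)
    have lower: "c / 2 * x \<le> p n"
      unfolding pn using elim x by (intro mult_right_mono) auto
    have pos: "p n > 0"
      using lower x assms(2) by (meson half_gt_zero less_le_trans mult_pos_pos)
    have upper: "p n \<le> K * x"
      unfolding pn using elim x by (intro mult_right_mono) (auto simp: K_def)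
    define q where "q = 2 ^ 2 ^ d * K ^ 2 ^ d * real n powr (- real d + 1 + \<delta> - \<eta>)"
    have q: "q \<ge> 0"
      by (simp add: q_def K_def)
    have "partial_recovery_loss n d (p n) \<le> q / p n"
    proof (rule partial_recovery_loss_le[OF pos q])
      fix h assume "h \<in> nsets {1..n} d"
      then show "measure_pmf.prob (random_hypergraph n d (p n))
          {H. h \<notin> H \<and> nsets h 2 \<subseteq> Proj n H} \<le> q"
        unfolding q_def \<eta>_def using elim assms(1,3) pos upper
        by (intro prob_false_clique_le) (auto simp: x_def K_def)
    qed
    also have "\<dots> \<le> q / (c / 2 * x)"
      using lower x assms(2) q by (intro divide_left_mono) (auto intro: mult_pos_pos pos)
    \<comment> \<open>Splitting off the order x of p lets it cancel against the denominator, leaving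
      only the gain from the gap.\<close>
    also have "q = 2 ^ 2 ^ d * K ^ 2 ^ d * (x * real n powr (- \<eta>))"
      by (simp add: q_def x_def powr_add[symmetric])
    also have "\<dots> / (c / 2 * x) = W * real n powr (- \<eta>)"
      using x assms(2) by (simp add: W_def)
    finally show ?case
      using partial_recovery_loss_nonneg pos by (simp add: less_imp_le)
  qed
  have "(\<lambda>n. W * real n powr (- \<eta>)) \<longlonglongrightarrow> W * 0"
    using \<eta> by (intro tendsto_mult tendsto_const tendsto_neg_powr filterlim_real_sequentially) auto
  then have lim: "(\<lambda>n. W * real n powr (- \<eta>)) \<longlonglongrightarrow> 0"
    by simp
  have "(\<lambda>n. partial_recovery_loss n d (p n)) \<longlonglongrightarrow> 0"
  proof (rule real_tendsto_sandwich[OF _ _ tendsto_const lim])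
    show "\<forall>\<^sub>F n in sequentially. 0 \<le> partial_recovery_loss n d (p n)"
      using bounds by (rule eventually_mono) blast
    show "\<forall>\<^sub>F n in sequentially. partial_recovery_loss n d (p n) \<le> W * real n powr (- \<eta>)"
      using bounds by (rule eventually_mono) blast
  qed
  then show ?thesis
    unfolding almost_exact_recovery_def by (intro smalloI_tendsto) simp_all
qed

end
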